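(* Let $n\ge 1$ be an integer and let $A$ be a symmetric $(n\times n)$-matrix over $\mathbb{R}$. The procedure described in the context, run on input $(n,A)$, terminates, and it outputs precisely the non-empty subsets $S\subset\{1,\dots,n\}$ having the property that the corresponding principal submatrix $A_S$ is positive definite.
   Context: For $S\subset\{1,\dots,n\}$, $A_S$ denotes the principal submatrix of $A$ formed by the rows and columns with indices in $S$. The procedure uses an integer variable $k$ and a set variable $S\subset\{1,\dots,n\}$, and works as follows (with exact real arithmetic). Initialization: $k\leftarrow 1$, $S\leftarrow\{1\}$. While $S\neq\emptyset$, repeat the following loop body: Step 1. If $\det A_S>0$, then output $S$; otherwise set $S\leftarrow S\setminus\{k\}$. Step 2. If $k<n$, then set $k\leftarrow k+1$ and afterwards $S\leftarrow S\cup\{k\}$. Otherwise (i.e. $k=n$) set $S\leftarrow S\setminus\{k\}$, and then, if $S\neq\emptyset$, perform in order: $k\leftarrow\max S$; $S\leftarrow S\setminus\{k\}$; $k\leftarrow k+1$; $S\leftarrow S\cup\{k\}$. When $S=\emptyset$ at the loop test, the procedure stops. *)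

theory Defs
  imports
    "Jordan_Normal_Form.Determinant"
    "Jordan_Normal_Form.DL_Submatrix"
    "HOL-Library.While_Combinator"
begin

(* Index sets are subsets of {1..n}, whereas the entries of a mat are indexed from 0. *)
definition principal_submatrix :: "'a mat \<Rightarrow> nat set \<Rightarrow> 'a mat" where
  "principal_submatrix A S = submatrix A ((\<lambda>i. i - 1) ` S) ((\<lambda>i. i - 1) ` S)"

definition symmetric_matrix :: "'a mat \<Rightarrow> bool" where
  "symmetric_matrix A \<longleftrightarrow> transpose_mat A = A"

definition positive_definite :: "real mat \<Rightarrow> bool" where
  "positive_definite M \<longleftrightarrow> symmetric_matrix M \<and>
     (\<forall>v \<in> carrier_vec (dim_row M). v \<noteq> 0\<^sub>v (dim_row M) \<longrightarrow> v \<bullet> (M *\<^sub>v v) > 0)"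

(* A state (k, S, out) consists of the two program variables and the list of the
   sets that have been output so far, in chronological order. *)
type_synonym state = "nat \<times> nat set \<times> nat set list"

fun step1 :: "real mat \<Rightarrow> state \<Rightarrow> state" where
  "step1 A (k, S, out) =
     (if det (principal_submatrix A S) > 0 then (k, S, out @ [S]) else (k, S - {k}, out))"

fun step2 :: "nat \<Rightarrow> state \<Rightarrow> state" where
  "step2 n (k, S, out) =
     (if k < n then (k + 1, S \<union> {k + 1}, out)
      else
        (let T = S - {k} in
         if T \<noteq> {} then
           (let m = Max T in (m + 1, (T - {m}) \<union> {m + 1}, out))
         else (k, T, out)))"

(* None means that the loop does not terminate. *)
definition run_procedure :: "nat \<Rightarrow> real mat \<Rightarrow> nat set list option" where
  "run_procedure n A =
     map_option (\<lambda>(k, S, out). out)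
       (while_option (\<lambda>(k, S, out). S \<noteq> {}) (\<lambda>s. step2 n (step1 A s)) (1, {1}, []))"

end

theory Submission
  imports Defs
begin

text \<open>
  The correctness of the procedure rests on a local fact about determinants and on a fact about
  the order in which the subsets of \<open>{1..n}\<close> are visited.

  The local fact is the inductive step of Sylvester's criterion: if deleting the last row and
  column of a symmetric matrix \<open>B\<close> leaves a positive definite matrix \<open>C\<close>, then \<open>B\<close> is positive
  definite iff \<open>det B > 0\<close>. The last column \<open>w\<close> of the adjugate of \<open>B\<close> makes this visible: its last
  entry is \<open>det C\<close>, and \<open>B w\<close> is \<open>det B\<close> times the last unit vector, so that \<open>w\<close> is orthogonal, for
  the form given by \<open>B\<close>, to every vector with last entry \<open>0\<close>. The form therefore splits into the
  form of \<open>C\<close> and a square with coefficient \<open>det B * det C\<close>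
  (\<open>quadratic_form_completed_square\<close>).

  For the order of the visits, arrange the nonempty subsets of \<open>{1..n}\<close> in a forest, where the
  parent of \<open>S\<close> is \<open>S - {Max S}\<close>; the descendants of \<open>S\<close> are the sets that have \<open>S\<close> as an initial
  segment, and the leaves are the sets containing \<open>n\<close>. The procedure is a depth-first traversal
  in preorder, which descends into the subtree of \<open>S\<close> when the determinant is positive and skips
  this subtree otherwise. Skipping loses nothing, because if an index set has a positive definite
  principal submatrix, then so do its initial segments
  (\<open>positive_definite_principal_submatrix_prefix\<close>). It follows also that the parent of the current
  set always has a positive definite principal submatrix: this is exactly the hypothesis under
  which the sign of the determinant decides positive definiteness.

  The set \<open>pending n S\<close> of the index sets that are not yet passed when \<open>S\<close> is current serves two
  purposes. The invariant says that the output consists of the wanted sets outside \<open>pending n S\<close>,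
  and the cardinality of \<open>pending n S\<close> decreases with every iteration; \<open>pending_extend\<close>,
  \<open>pending_advance\<close> and \<open>later_remove_n\<close> describe how it changes.
\<close>

section \<open>Positive definiteness and a bordered determinant\<close>

lemma symmetric_matrix_index:
  assumes "symmetric_matrix B" and "B \<in> carrier_mat n n" and "i < n" and "j < n"
  shows "B $$ (i, j) = B $$ (j, i)"
  using assms unfolding symmetric_matrix_def by (metis carrier_matD index_transpose_mat(1))

lemma symmetric_matrixI:
  assumes "B \<in> carrier_mat n n" and "\<And>i j. i < n \<Longrightarrow> j < n \<Longrightarrow> B $$ (i, j) = B $$ (j, i)"
  shows "symmetric_matrix B"
  unfolding symmetric_matrix_def
  by (rule eq_matI) (use assms(1) in \<open>auto simp: assms(2)[symmetric]\<close>)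

lemma symmetric_matrix_mat_delete:
  assumes B: "B \<in> carrier_mat n n" and sym: "symmetric_matrix B"
  shows "symmetric_matrix (mat_delete B i i)"
proof (rule symmetric_matrixI[OF mat_delete_carrier[OF B]])
  fix p q assume "p < n - 1" "q < n - 1"
  then show "mat_delete B i i $$ (p, q) = mat_delete B i i $$ (q, p)"
    using B by (simp add: mat_delete_def symmetric_matrix_index[OF sym B])
qed

lemma quadratic_form_leading_block:
  fixes B :: "'a :: comm_ring_1 mat"
  assumes B: "B \<in> carrier_mat (Suc m) (Suc m)"
    and a: "a \<in> carrier_vec (Suc m)" and last: "a $ m = 0"
  defines "u \<equiv> vec m (\<lambda>i. a $ i)"
  shows "a \<bullet> (B *\<^sub>v a) = u \<bullet> (mat_delete B m m *\<^sub>v u)"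
proof -
  have "(B *\<^sub>v a) $ i = (mat_delete B m m *\<^sub>v u) $ i" if "i < m" for i
    using that B a last
    by (auto simp: scalar_prod_def u_def mat_delete_def intro!: sum.cong)
  then show ?thesis
    using B a last by (auto simp: scalar_prod_def u_def mat_delete_def intro!: sum.cong)
qed

lemma positive_definite_mat_delete:
  fixes B :: "real mat"
  assumes B: "B \<in> carrier_mat (Suc m) (Suc m)" and pd: "positive_definite B"
  shows "positive_definite (mat_delete B m m)"
  unfolding positive_definite_def
proof (intro conjI ballI impI)
  show "symmetric_matrix (mat_delete B m m)"
    using symmetric_matrix_mat_delete[OF B] pd by (simp add: positive_definite_def)
next
  fix u :: "real vec" assume "u \<in> carrier_vec (dim_row (mat_delete B m m))"
    and u0: "u \<noteq> 0\<^sub>v (dim_row (mat_delete B m m))"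
  with B have u: "u \<in> carrier_vec m" by simp
  define a where "a = vec (Suc m) (\<lambda>i. if i < m then u $ i else 0)"
  have ua: "vec m (\<lambda>i. a $ i) = u" using u by (auto simp: a_def)
  have "a \<noteq> 0\<^sub>v (Suc m)"
  proof
    assume "a = 0\<^sub>v (Suc m)"
    with ua have "u = 0\<^sub>v m" by auto
    with u0 B show False by simp
  qed
  then have "a \<bullet> (B *\<^sub>v a) > 0"
    using pd B by (simp add: positive_definite_def a_def)
  then show "u \<bullet> (mat_delete B m m *\<^sub>v u) > 0"
    using quadratic_form_leading_block[OF B, of a] ua by (simp add: a_def)
qed

text \<open>This is Cramer's rule for the equation \<open>B x = e\<close>, with the last unit vector \<open>e\<close> and multiplied
  by \<open>det B\<close>.\<close>

lemma adj_mat_last_col: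
  fixes B :: "'a :: comm_ring_1 mat"
  assumes B: "B \<in> carrier_mat (Suc m) (Suc m)"
  defines "w \<equiv> col (adj_mat B) m"
  shows "w \<in> carrier_vec (Suc m)"
    and "w $ m = det (mat_delete B m m)"
    and "B *\<^sub>v w = det B \<cdot>\<^sub>v unit_vec (Suc m) m"
proof -
  note adj = adj_mat[OF B]
  show "w \<in> carrier_vec (Suc m)" using adj(1) col_dim[of "adj_mat B" m] by (metis w_def carrier_matD(1))
  show "w $ m = det (mat_delete B m m)"
    using B by (simp add: w_def adj_mat_def cofactor_def)
  have "B *\<^sub>v w = col (B * adj_mat B) m"
    using col_mult2[OF B adj(1), of m] by (simp add: w_def)
  also have "\<dots> = det B \<cdot>\<^sub>v unit_vec (Suc m) m"
    unfolding adj(2) by (rule eq_vecI) auto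
  finally show "B *\<^sub>v w = det B \<cdot>\<^sub>v unit_vec (Suc m) m" .
qed

text \<open>Let \<open>w\<close> be the last column of the adjugate. Subtracting the multiple \<open>t w\<close> from \<open>v\<close> kills the
  last entry, and what is left is orthogonal to \<open>w\<close> because \<open>B w\<close> is a multiple of the last unit
  vector.\<close>

lemma quadratic_form_completed_square:
  fixes B :: "real mat"
  assumes B: "B \<in> carrier_mat (Suc m) (Suc m)" and sym: "symmetric_matrix B"
    and v: "v \<in> carrier_vec (Suc m)"
    and d0: "det (mat_delete B m m) \<noteq> 0"
  defines "t \<equiv> v $ m / det (mat_delete B m m)"
  defines "u \<equiv> vec m (\<lambda>i. v $ i - t * col (adj_mat B) m $ i)"
  shows "v \<bullet> (B *\<^sub>v v) =
    u \<bullet> (mat_delete B m m *\<^sub>v u) + t\<^sup>2 * (det B * det (mat_delete B m m))"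
proof -
  let ?d = "det (mat_delete B m m)" and ?e = "unit_vec (Suc m) m :: real vec"
  define w where "w = col (adj_mat B) m"
  note w = adj_mat_last_col[OF B, folded w_def]
  define a where "a = v - t \<cdot>\<^sub>v w"
  have a: "a \<in> carrier_vec (Suc m)" using v w(1) by (simp add: a_def)
  have am: "a $ m = 0" using v w(1,2) d0 by (simp add: a_def t_def)
  have va: "v = a + t \<cdot>\<^sub>v w" using v w(1) by (intro eq_vecI) (auto simp: a_def)
  have Ba: "B *\<^sub>v a \<in> carrier_vec (Suc m)" using B a by simp
  have x_e: "x \<bullet> (c \<cdot>\<^sub>v ?e) = c * x $ m" if "x \<in> carrier_vec (Suc m)" for x :: "real vec" and c
    using that scalar_prod_smult_right by auto
  have w_Ba: "w \<bullet> (B *\<^sub>v a) = 0"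
  proof -
    have "w \<bullet> (B *\<^sub>v a) = (B *\<^sub>v w) \<bullet> a"
      using transpose_vec_mult_scalar[OF B a w(1)] sym by (simp add: symmetric_matrix_def)
    also have "\<dots> = a \<bullet> (B *\<^sub>v w)" using B a w(1) by (intro comm_scalar_prod) auto
    also have "\<dots> = 0" unfolding w(3) x_e[OF a] am by simp
    finally show ?thesis .
  qed
  have "B *\<^sub>v v = B *\<^sub>v a + (t * det B) \<cdot>\<^sub>v ?e"
    unfolding va using B a w(1)
    by (simp add: mult_add_distrib_mat_vec mult_mat_vec w(3) smult_smult_assoc)
  then have "v \<bullet> (B *\<^sub>v v) = v \<bullet> (B *\<^sub>v a) + t * det B * v $ m"
    using scalar_prod_add_distrib[OF v Ba, of "(t * det B) \<cdot>\<^sub>v ?e"] x_e[OF v] by simp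
  also have "v \<bullet> (B *\<^sub>v a) = a \<bullet> (B *\<^sub>v a) + t * (w \<bullet> (B *\<^sub>v a))"
    using add_scalar_prod_distrib[OF a _ Ba, of "t \<cdot>\<^sub>v w"] w(1) Ba by (simp add: va[symmetric])
  also have "a \<bullet> (B *\<^sub>v a) = u \<bullet> (mat_delete B m m *\<^sub>v u)"
  proof -
    have "vec m (\<lambda>i. a $ i) = u"
      using v w(1) unfolding a_def u_def w_def[symmetric] by (intro eq_vecI) auto
    then show ?thesis using quadratic_form_leading_block[OF B a am] by simp
  qed
  also have "v $ m = t * ?d" using d0 by (simp add: t_def)
  finally show ?thesis by (simp add: w_Ba power2_eq_square algebra_simps)
qed

text \<open>Evaluate the form at the adjugate column: the value is \<open>det B * det C\<close>, where \<open>C\<close> is the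
  leading block, whose determinant is positive by induction.\<close>

lemma positive_definite_det_pos:
  assumes "B \<in> carrier_mat m m" and "positive_definite B"
  shows "det B > 0"
  using assms
proof (induction m arbitrary: B)
  case 0
  then show ?case by simp
next
  case (Suc m)
  let ?C = "mat_delete B m m"
  note B = Suc.prems(1) and pd = Suc.prems(2)
  define w where "w = col (adj_mat B) m"
  note w = adj_mat_last_col[OF B, folded w_def]
  have dC: "det ?C > 0"
    using Suc.IH[of ?C] mat_delete_carrier[OF B, of m m] positive_definite_mat_delete[OF B pd]
    by simp
  then have "w \<noteq> 0\<^sub>v (Suc m)" using w(2) by auto
  then have "0 < w \<bullet> (B *\<^sub>v w)"
    using pd B w(1) by (simp add: positive_definite_def)
  also have "\<dots> = det B * det ?C" using w by auto
  finally show ?case using dC by (simp add: zero_less_mult_iff)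
qed

text \<open>The inductive step of Sylvester's criterion, read off from the completed square.\<close>

lemma positive_definite_iff_det_pos:
  assumes B: "B \<in> carrier_mat (Suc m) (Suc m)" and sym: "symmetric_matrix B"
    and pdC: "positive_definite (mat_delete B m m)"
  shows "positive_definite B \<longleftrightarrow> det B > 0"
proof
  show "det B > 0" if "positive_definite B"
    by (rule positive_definite_det_pos[OF B that])
next
  assume dB: "det B > 0"
  let ?C = "mat_delete B m m"
  have C: "?C \<in> carrier_mat m m" using mat_delete_carrier[OF B, of m m] by simp
  have dC: "det ?C > 0" by (rule positive_definite_det_pos[OF C pdC])
  show "positive_definite B"
    unfolding positive_definite_def
  proof (intro conjI ballI impI sym)
    fix v :: "real vec" assume "v \<in> carrier_vec (dim_row B)" and "v \<noteq> 0\<^sub>v (dim_row B)"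
    with B have v: "v \<in> carrier_vec (Suc m)" and v0: "v \<noteq> 0\<^sub>v (Suc m)" by auto
    define t where "t = v $ m / det ?C"
    define u where "u = vec m (\<lambda>i. v $ i - t * col (adj_mat B) m $ i)"
    have eq: "v \<bullet> (B *\<^sub>v v) = u \<bullet> (?C *\<^sub>v u) + t\<^sup>2 * (det B * det ?C)"
      using quadratic_form_completed_square[OF B sym v] dC by (simp add: t_def u_def)
    have u: "u \<in> carrier_vec m" by (simp add: u_def)
    have pos: "u \<bullet> (?C *\<^sub>v u) > 0" if "u \<noteq> 0\<^sub>v m"
      using pdC u that unfolding positive_definite_def carrier_matD(1)[OF C] by blast
    show "v \<bullet> (B *\<^sub>v v) > 0"
    proof (cases "u = 0\<^sub>v m")
      case False
      then show ?thesis using eq pos dB dC by (simp add: add_pos_nonneg)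
    next
      case True
      have "t \<noteq> 0"
      proof
        assume "t = 0"
        have "v $ i = 0" if "i < Suc m" for i
        proof (cases "i = m")
          case True
          with \<open>t = 0\<close> dC show ?thesis by (simp add: t_def)
        next
          case False
          with that have "i < m" by simp
          with \<open>t = 0\<close> have "u $ i = v $ i" by (simp add: u_def)
          with \<open>u = 0\<^sub>v m\<close>\<open>i < m\<close> show ?thesis by simp
        qed
        with v v0 show False by auto
      qed
      with True eq C dB dC show ?thesis by simp
    qed
  qed
qed

section \<open>Principal submatrices\<close>

lemma card_pred_image:
  fixes S :: "nat set"
  assumes "S \<subseteq> {1..n}"
  shows "card {i. i < n \<and> i \<in> (\<lambda>i. i - 1) ` S} = card S"
proof -
  have "i - 1 < n" if "i \<in> S" for i
    using subsetD[OF assms that] by auto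
  then have "{i. i < n \<and> i \<in> (\<lambda>i. i - 1) ` S} = (\<lambda>i. i - 1) ` S"
    by blast
  moreover have "inj_on (\<lambda>i. i - 1) S"
    using assms by (intro inj_on_diff_nat) auto
  ultimately show ?thesis by (simp add: card_image)
qed

lemma principal_submatrix_carrier:
  assumes "A \<in> carrier_mat n n" and "S \<subseteq> {1..n}"
  shows "principal_submatrix A S \<in> carrier_mat (card S) (card S)"
  using assms card_pred_image[OF assms(2)]
  by (intro carrier_matI) (auto simp: principal_submatrix_def dim_submatrix)

lemma principal_submatrix_symmetric:
  assumes A: "A \<in> carrier_mat n n" and sym: "symmetric_matrix A" and S: "S \<subseteq> {1..n}"
  shows "symmetric_matrix (principal_submatrix A S)"
proof (rule symmetric_matrixI[OF principal_submatrix_carrier[OF A S]])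
  fix i j assume ij: "i < card S" "j < card S"
  have "pick ((\<lambda>i. i - 1) ` S) l < n" if "l < card S" for l
    using pick_le that card_pred_image[OF S] by metis
  with ij have "A $$ (pick ((\<lambda>i. i - 1) ` S) i, pick ((\<lambda>i. i - 1) ` S) j) =
      A $$ (pick ((\<lambda>i. i - 1) ` S) j, pick ((\<lambda>i. i - 1) ` S) i)"
    using symmetric_matrix_index[OF sym A] by blast
  then show "principal_submatrix A S $$ (i, j) = principal_submatrix A S $$ (j, i)"
    using ij A card_pred_image[OF S] by (simp add: principal_submatrix_def submatrix_def)
qed

text \<open>The rows and columns of a principal submatrix are in increasing order of their indices, so the
  last one belongs to \<open>Max S\<close>.\<close>

lemma mat_delete_principal_submatrix:
  assumes A: "A \<in> carrier_mat n n" and S: "S \<subseteq> {1..n}" "S \<noteq> {}"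
  shows "mat_delete (principal_submatrix A S) (card S - 1) (card S - 1) =
    principal_submatrix A (S - {Max S})"
proof -
  have fin: "finite S" using S finite_subset by blast
  let ?p = "\<lambda>i::nat. i - 1"
  let ?T = "S - {Max S}"
  have T: "?T \<subseteq> {1..n}" using S by auto
  have cT: "card ?T = card S - 1" using fin S by simp
  have c0: "card S > 0" using fin S by (simp add: card_gt_0_iff)
  have img: "?p ` ?T = {a. a < Max S - 1 \<and> a \<in> ?p ` S}"
  proof (intro equalityI subsetI)
    fix a assume "a \<in> ?p ` ?T"
    then obtain s where s: "s \<in> S" "s \<noteq> Max S" "a = s - 1" by auto
    with fin have "s < Max S" by (simp add: order_neq_le_trans)
    moreover have "s \<ge> 1" using s S by auto
    ultimately have "s - 1 < Max S - 1" by simp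
    with s show "a \<in> {a. a < Max S - 1 \<and> a \<in> ?p ` S}" by auto
  next
    fix a assume "a \<in> {a. a < Max S - 1 \<and> a \<in> ?p ` S}"
    then show "a \<in> ?p ` ?T" by auto
  qed
  have inj: "inj_on ?p ?T"
    using S by (intro inj_on_diff_nat) auto
  have pick: "pick (?p ` S) i = pick (?p ` ?T) i" if "i < card S - 1" for i
    using that pick_reduce_set[of i "Max S - 1" "?p ` S"] card_image[OF inj] cT
    unfolding img by simp
  note cards = card_pred_image[OF S(1)] card_pred_image[OF T]
  show ?thesis
  proof (rule eq_matI)
    fix i j
    assume "i < dim_row (principal_submatrix A ?T)" "j < dim_col (principal_submatrix A ?T)"
    then have ij: "i < card S - 1" "j < card S - 1"
      using principal_submatrix_carrier[OF A T] cT by auto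
    then have "i < card S" "j < card S" by auto
    then show "mat_delete (principal_submatrix A S) (card S - 1) (card S - 1) $$ (i, j) =
      principal_submatrix A ?T $$ (i, j)"
      using ij A cT cards pick by (simp add: mat_delete_def principal_submatrix_def submatrix_def)
  qed (use principal_submatrix_carrier[OF A T] principal_submatrix_carrier[OF A S(1)] cT in auto)
qed


lemma positive_definite_principal_submatrix_remove_Max:
  assumes A: "A \<in> carrier_mat n n" and S: "S \<subseteq> {1..n}" "S \<noteq> {}"
    and pd: "positive_definite (principal_submatrix A S)"
  shows "positive_definite (principal_submatrix A (S - {Max S}))"
proof -
  have "card S > 0" using S finite_subset[OF S(1)] by (simp add: card_gt_0_iff)
  then have "principal_submatrix A S \<in> carrier_mat (Suc (card S - 1)) (Suc (card S - 1))"
    using principal_submatrix_carrier[OF A S(1)] by simp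
  from positive_definite_mat_delete[OF this pd] show ?thesis
    by (simp only: mat_delete_principal_submatrix[OF A S])
qed

text \<open>This is what justifies skipping a subtree: no descendant of a rejected set qualifies.\<close>

lemma positive_definite_principal_submatrix_prefix:
  assumes A: "A \<in> carrier_mat n n" and "T \<subseteq> {1..n}"
    and "positive_definite (principal_submatrix A T)"
  shows "positive_definite (principal_submatrix A (T \<inter> {..k}))"
  using assms(2,3)
proof (induction "card T" arbitrary: T rule: less_induct)
  case less
  have fin: "finite T" using less.prems(1) finite_subset by blast
  show ?case
  proof (cases "T \<subseteq> {..k}")
    case True
    then show ?thesis using less.prems by (simp add: inf_absorb1)
  next
    case False
    then obtain t where t: "t \<in> T" "k < t" by (meson atMost_iff leI subsetI)
    then have ne: "T \<noteq> {}" and big: "Max T > k"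
      using Max_ge[OF fin t(1)] by auto
    let ?T = "T - {Max T}"
    have "card ?T < card T" by (rule card_Diff1_less[OF fin Max_in[OF fin ne]])
    moreover have "?T \<subseteq> {1..n}" using less.prems(1) by auto
    moreover have "positive_definite (principal_submatrix A ?T)"
      by (rule positive_definite_principal_submatrix_remove_Max[OF A less.prems(1) ne less.prems(2)])
    ultimately have "positive_definite (principal_submatrix A (?T \<inter> {..k}))"
      by (rule less.hyps)
    moreover have "?T \<inter> {..k} = T \<inter> {..k}" using big by auto
    ultimately show ?thesis by simp
  qed
qed

lemma det_principal_submatrix_pos_iff:
  assumes A: "A \<in> carrier_mat n n" and sym: "symmetric_matrix A"
    and S: "S \<subseteq> {1..n}" "S \<noteq> {}"
    and pd: "positive_definite (principal_submatrix A (S - {Max S}))"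
  shows "det (principal_submatrix A S) > 0 \<longleftrightarrow> positive_definite (principal_submatrix A S)"
proof -
  have "card S > 0" using S finite_subset[OF S(1)] by (simp add: card_gt_0_iff)
  then have "principal_submatrix A S \<in> carrier_mat (Suc (card S - 1)) (Suc (card S - 1))"
    using principal_submatrix_carrier[OF A S(1)] by simp
  from positive_definite_iff_det_pos[OF this principal_submatrix_symmetric[OF A sym S(1)]] pd
  show ?thesis
    unfolding mat_delete_principal_submatrix[OF A S] by blast
qed

section \<open>The order in which index sets are visited\<close>

text \<open>The subtree rooted at \<open>S\<close>, including \<open>S\<close> itself. The empty set marks the end of the traversal
  and is given no descendants.\<close>

definition descendants :: "nat \<Rightarrow> nat set \<Rightarrow> nat set set" where
  "descendants n S = {T. S \<noteq> {} \<and> T \<subseteq> {1..n} \<and> T \<inter> {..Max S} = S}"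

text \<open>The index sets that come after the whole subtree of \<open>S\<close> in preorder. Here \<open>d\<close> is the least
  element in which \<open>T\<close> and \<open>S\<close> differ; that \<open>T\<close> has an element beyond \<open>d\<close> says that \<open>T\<close> is not an
  initial segment of \<open>S\<close>, that is, not an ancestor, which would come before \<open>S\<close>.\<close>

definition later :: "nat \<Rightarrow> nat set \<Rightarrow> nat set set" where
  "later n S =
     {T. T \<subseteq> {1..n} \<and> (\<exists>d\<in>S. d \<notin> T \<and> T \<inter> {..<d} = S \<inter> {..<d} \<and> T \<inter> {d<..} \<noteq> {})}"

definition pending :: "nat \<Rightarrow> nat set \<Rightarrow> nat set set" where
  "pending n S = descendants n S \<union> later n S"

lemma pending_empty: "pending n {} = {}"
  by (simp add: pending_def descendants_def later_def)

lemma finite_pending: "finite (pending n S)"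
  by (rule finite_subset[of _ "Pow {1..n}"]) (auto simp: pending_def descendants_def later_def)

lemma self_in_descendants:
  assumes "S \<subseteq> {1..n}" and "S \<noteq> {}"
  shows "S \<in> descendants n S"
  using assms finite_subset[OF assms(1)] by (auto simp: descendants_def)

lemma descendants_later_disjoint: "descendants n S \<inter> later n S = {}"
  by (auto simp: descendants_def later_def)

lemma descendants_Max_eq_n:
  assumes "S \<subseteq> {1..n}" and "S \<noteq> {}" and "Max S = n"
  shows "descendants n S = {S}"
proof -
  have "T \<inter> {..Max S} = T" if "T \<subseteq> {1..n}" for T
    using that assms(3) by auto
  moreover have "S \<inter> {..Max S} = S" using assms(1,3) by auto
  ultimately show ?thesis using assms(1,2) by (auto simp: descendants_def)
qed

lemma initial_pending:
  assumes "n \<ge> 1"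
  shows "pending n {1} = Pow {1..n} - {{}}"
proof (intro equalityI subsetI)
  fix T assume "T \<in> pending n {1}"
  then show "T \<in> Pow {1..n} - {{}}" by (auto simp: pending_def descendants_def later_def)
next
  fix T assume "T \<in> Pow {1..n} - {{}}"
  then have T: "T \<subseteq> {1..n}" "T \<noteq> {}" by auto
  show "T \<in> pending n {1}"
  proof (cases "1 \<in> T")
    case True
    with T have "T \<inter> {..1} = {1}" by force
    with T show ?thesis by (simp add: pending_def descendants_def)
  next
    case False
    from T obtain t where t: "t \<in> T" by blast
    with False T have "1 < t" by (metis atLeastAtMost_iff le_neq_implies_less subsetD)
    moreover have "T \<inter> {..<1} = {1} \<inter> {..<1}" using T by auto
    ultimately have "T \<in> later n {1}" using T False t by (auto simp: later_def)
    then show ?thesis by (simp add: pending_def)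
  qed
qed

lemma Max_insert_Suc:
  assumes "finite S" and "\<And>s. s \<in> S \<Longrightarrow> s \<le> k"
  shows "Max (insert (k + 1) S) = k + (1::nat)"
  using assms by (intro Max_eqI) force+

text \<open>Descending to the first child \<open>S \<union> {k + 1}\<close> passes \<open>S\<close> only. Among the proper descendants
  \<open>T\<close> of \<open>S\<close>, those with \<open>k + 1 \<in> T\<close> are descendants of the child, and the others are later than
  the child, with \<open>k + 1\<close> as the first difference.\<close>

lemma pending_extend:
  assumes S: "S \<subseteq> {1..n}" "S \<noteq> {}" and k: "Max S = k" "k < n"
  shows "pending n (insert (k + 1) S) = pending n S - {S}"
proof -
  have fin: "finite S" using S finite_subset by blast
  have le: "s \<le> k" if "s \<in> S" for s using that fin k by auto
  let ?S = "insert (k + 1) S"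
  have mx: "Max ?S = k + 1" by (rule Max_insert_Suc[OF fin le])
  have below: "?S \<inter> {..<d} = S \<inter> {..<d}" if "d \<in> S" for d
    using le[OF that] by auto
  have new: "?S \<inter> {..<k + 1} = S" using le by (auto simp: less_Suc_eq_le)
  have "T \<in> pending n ?S \<longleftrightarrow> T \<in> pending n S - {S}" for T
  proof -
    consider "T \<inter> {..k} = S" | "T \<inter> {..k} \<noteq> S" by blast
    then show ?thesis
    proof cases
      case 1
      have ST: "S \<subseteq> T" using 1 by auto
      have splitT: "T \<inter> {..k + 1} = (if k + 1 \<in> T then ?S else S)"
        using 1 by (auto simp: le_Suc_eq)
      have lt: "T \<inter> {..<k + 1} = S" using 1 by (simp add: lessThan_Suc_atMost)
      have neq: "T \<noteq> S \<longleftrightarrow> k + 1 \<in> T \<or> T \<inter> {k + 1<..} \<noteq> {}"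
      proof -
        have "T = S \<union> (T \<inter> {k<..})" using 1 by auto
        moreover have "S \<inter> {k<..} = {}" using le by force
        moreover have "T \<inter> {k<..} = {} \<longleftrightarrow> k + 1 \<notin> T \<and> T \<inter> {k + 1<..} = {}"
          by (auto simp: disjoint_iff) (metis Suc_lessI)+
        ultimately show ?thesis by blast
      qed
      have "T \<in> later n ?S \<longleftrightarrow> T \<subseteq> {1..n} \<and> k + 1 \<notin> T \<and> T \<inter> {k + 1<..} \<noteq> {}"
        using ST lt new by (auto simp: later_def)
      moreover have "T \<in> descendants n ?S \<longleftrightarrow> T \<subseteq> {1..n} \<and> k + 1 \<in> T"
        unfolding descendants_def mx mem_Collect_eq splitT using new by auto
      moreover have "T \<in> descendants n S \<longleftrightarrow> T \<subseteq> {1..n}"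
        by (simp add: descendants_def S k 1)
      then have "T \<in> pending n S \<longleftrightarrow> T \<subseteq> {1..n}"
        by (auto simp: pending_def later_def)
      ultimately show ?thesis using neq by (auto simp: pending_def)
    next
      case 2
      have "T \<noteq> S" using 2 le by auto
      moreover have "T \<notin> descendants n ?S"
      proof
        assume "T \<in> descendants n ?S"
        then have *: "T \<inter> {..k + 1} = ?S" unfolding descendants_def mx by auto
        have "T \<inter> {..k} = (T \<inter> {..k + 1}) \<inter> {..k}" by auto
        also have "\<dots> = S" unfolding * using le by auto
        finally show False using 2 by simp
      qed
      moreover have "T \<notin> descendants n S" using 2 k by (simp add: descendants_def)
      moreover have "T \<inter> {..<k + 1} \<noteq> ?S \<inter> {..<k + 1}"
        using 2 unfolding new by (simp add: lessThan_Suc_atMost)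
      then have "T \<in> later n ?S \<longleftrightarrow> T \<in> later n S"
        unfolding later_def using below by auto
      ultimately show ?thesis by (simp add: pending_def)
    qed
  qed
  then show ?thesis by blast
qed

text \<open>Replacing \<open>k = Max S\<close> by \<open>k + 1\<close> is the move to the next sibling, and it passes precisely the
  subtree of \<open>S\<close>. The sets later than \<open>S\<close> with first difference \<open>k\<close> either contain \<open>k + 1\<close>, and are
  then descendants of the sibling, or are later than it with first difference \<open>k + 1\<close>; for the
  first differences below \<open>k\<close> the two sets agree.\<close>

lemma pending_advance:
  assumes S: "S \<subseteq> {1..n}" "S \<noteq> {}" and k: "Max S = k" "k < n"
  shows "pending n (insert (k + 1) (S - {k})) = later n S"
proof -
  have fin: "finite S" using S finite_subset by blast
  have le: "s \<le> k" if "s \<in> S" for s using that fin k by auto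
  have kS: "k \<in> S" using fin S k Max_in by blast
  let ?R = "S - {k}"
  let ?S = "insert (k + 1) ?R"
  have lt: "s < k" if "s \<in> ?R" for s using le that by force
  have mx: "Max ?S = k + 1" using fin le by (intro Max_insert_Suc) auto
  have below: "?S \<inter> {..<d} = S \<inter> {..<d}" if "d \<in> ?R" for d
    using lt[OF that] by auto
  have newS: "?S \<inter> {..<k + 1} = ?R" and oldS: "S \<inter> {..<k} = ?R"
    using lt le by force+
  have last: "(T \<inter> {..k + 1} = ?S) \<or> (k + 1 \<notin> T \<and> T \<inter> {..<k + 1} = ?R \<and> T \<inter> {k + 1<..} \<noteq> {})
      \<longleftrightarrow> k \<notin> T \<and> T \<inter> {..<k} = ?R \<and> T \<inter> {k<..} \<noteq> {}" (is "?l \<longleftrightarrow> ?r") for T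
  proof -
    have a: "T \<inter> {..<k + 1} = ?R \<longleftrightarrow> k \<notin> T \<and> T \<inter> {..<k} = ?R"
      using lt by (auto simp: set_eq_iff less_Suc_eq)
    have b: "T \<inter> {..k + 1} = ?S \<longleftrightarrow> k + 1 \<in> T \<and> T \<inter> {..<k + 1} = ?R"
    proof
      assume *: "T \<inter> {..k + 1} = ?S"
      have "T \<inter> {..<k + 1} = (T \<inter> {..k + 1}) \<inter> {..<k + 1}" by auto
      with * newS show "k + 1 \<in> T \<and> T \<inter> {..<k + 1} = ?R" by auto
    next
      assume *: "k + 1 \<in> T \<and> T \<inter> {..<k + 1} = ?R"
      have "T \<inter> {..k + 1} = (T \<inter> {..<k + 1}) \<union> (T \<inter> {k + 1})" by auto
      with * show "T \<inter> {..k + 1} = ?S" by auto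
    qed
    have c: "T \<inter> {k<..} \<noteq> {} \<longleftrightarrow> k + 1 \<in> T \<or> T \<inter> {k + 1<..} \<noteq> {}"
      by (auto simp: disjoint_iff) (metis Suc_lessI)+
    show ?thesis unfolding b a c by argo
  qed
  have bex: "(\<exists>d\<in>S. P d) \<longleftrightarrow> (\<exists>d\<in>?R. P d) \<or> P k"
    and bex': "(\<exists>d\<in>?S. P d) \<longleftrightarrow> (\<exists>d\<in>?R. P d) \<or> P (k + 1)" for P
    using kS by blast+
  have split: "T \<in> later n S \<longleftrightarrow> T \<subseteq> {1..n} \<and>
      ((\<exists>d\<in>?R. d \<notin> T \<and> T \<inter> {..<d} = S \<inter> {..<d} \<and> T \<inter> {d<..} \<noteq> {}) \<or>
       (k \<notin> T \<and> T \<inter> {..<k} = ?R \<and> T \<inter> {k<..} \<noteq> {}))" for T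
    unfolding later_def mem_Collect_eq bex oldS ..
  have "(\<exists>d\<in>?R. d \<notin> T \<and> T \<inter> {..<d} = ?S \<inter> {..<d} \<and> T \<inter> {d<..} \<noteq> {}) \<longleftrightarrow>
      (\<exists>d\<in>?R. d \<notin> T \<and> T \<inter> {..<d} = S \<inter> {..<d} \<and> T \<inter> {d<..} \<noteq> {})" for T
    by (rule bex_cong[OF refl]) (simp only: below)
  then have split': "T \<in> later n ?S \<longleftrightarrow> T \<subseteq> {1..n} \<and>
      ((\<exists>d\<in>?R. d \<notin> T \<and> T \<inter> {..<d} = S \<inter> {..<d} \<and> T \<inter> {d<..} \<noteq> {}) \<or>
       (k + 1 \<notin> T \<and> T \<inter> {..<k + 1} = ?R \<and> T \<inter> {k + 1<..} \<noteq> {}))" for T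
    unfolding later_def mem_Collect_eq bex' newS by simp
  have "T \<in> pending n ?S \<longleftrightarrow> T \<in> later n S" for T
    unfolding pending_def Un_iff split split' descendants_def mx mem_Collect_eq
    using last[of T] insert_not_empty[of "k + 1" ?R] by argo
  then show ?thesis by blast
qed

text \<open>No set has an element beyond \<open>n\<close>, so in \<open>later\<close> the first difference is never \<open>n\<close>: after a
  leaf the traversal continues as after its parent.\<close>

lemma later_remove_n: "later n (S - {n}) = later n S"
proof -
  have "d \<in> S - {n} \<and> d \<notin> T \<and> T \<inter> {..<d} = (S - {n}) \<inter> {..<d} \<and> T \<inter> {d<..} \<noteq> {} \<longleftrightarrow>
      d \<in> S \<and> d \<notin> T \<and> T \<inter> {..<d} = S \<inter> {..<d} \<and> T \<inter> {d<..} \<noteq> {}"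
    if T: "T \<subseteq> {1..n}" for T d
  proof (cases "d < n")
    case True
    then have "(S - {n}) \<inter> {..<d} = S \<inter> {..<d}" by auto
    with True show ?thesis by simp
  next
    case False
    with T have "T \<inter> {d<..} = {}" by fastforce
    then show ?thesis by simp
  qed
  then show ?thesis
    unfolding later_def Bex_def by (rule Collect_cong[OF conj_cong[OF refl ex_cong1]])
qed

section \<open>Correctness of the procedure\<close>

definition pd_index_sets :: "nat \<Rightarrow> real mat \<Rightarrow> nat set set" where
  "pd_index_sets n A = {S. S \<noteq> {} \<and> S \<subseteq> {1..n} \<and> positive_definite (principal_submatrix A S)}"

text \<open>The condition on \<open>S - {k}\<close>, the parent of the current set, makes the determinant test
  decisive.\<close>

definition invariant :: "nat \<Rightarrow> real mat \<Rightarrow> state \<Rightarrow> bool" where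
  "invariant n A = (\<lambda>(k, S, out). S \<subseteq> {1..n} \<and>
     (S \<noteq> {} \<longrightarrow> k = Max S \<and> positive_definite (principal_submatrix A (S - {k}))) \<and>
     set out = pd_index_sets n A - pending n S)"

lemma positive_definite_empty:
  assumes "A \<in> carrier_mat n n"
  shows "positive_definite (principal_submatrix A {})"
  using principal_submatrix_carrier[OF assms, of "{}"]
  by (auto simp: positive_definite_def symmetric_matrix_def)

lemma descendants_pd_index_sets_disjoint:
  assumes A: "A \<in> carrier_mat n n"
    and "\<not> positive_definite (principal_submatrix A S)"
  shows "descendants n S \<inter> pd_index_sets n A = {}"
proof -
  have False if "T \<in> descendants n S" "T \<in> pd_index_sets n A" for T
  proof -
    from that have T: "T \<subseteq> {1..n}" "T \<inter> {..Max S} = S"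
      and "positive_definite (principal_submatrix A T)"
      by (auto simp: descendants_def pd_index_sets_def)
    with positive_definite_principal_submatrix_prefix[OF A, of T "Max S"] assms(2)
    show False by simp
  qed
  then show ?thesis by blast
qed

lemma set_out_step1:
  assumes A: "A \<in> carrier_mat n n" and sym: "symmetric_matrix A"
    and inv: "invariant n A (k, S, out)" and ne: "S \<noteq> {}"
    and step: "step1 A (k, S, out) = (k', S', out')"
  shows "k' = k"
    and "positive_definite (principal_submatrix A S) \<Longrightarrow>
      S' = S \<and> set out' = pd_index_sets n A - (pending n S - {S})"
    and "\<not> positive_definite (principal_submatrix A S) \<Longrightarrow>
      S' = S - {k} \<and> set out' = pd_index_sets n A - later n S"
proof -
  from inv ne have S: "S \<subseteq> {1..n}" and k: "k = Max S"
    and pd: "positive_definite (principal_submatrix A (S - {Max S}))"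
    and out: "set out = pd_index_sets n A - pending n S"
    by (auto simp: invariant_def)
  note iff = det_principal_submatrix_pos_iff[OF A sym S ne pd]
  show "k' = k" using step by (auto split: if_splits)
  show "S' = S \<and> set out' = pd_index_sets n A - (pending n S - {S})"
    if "positive_definite (principal_submatrix A S)"
  proof -
    have "S \<in> pd_index_sets n A" using that S ne by (simp add: pd_index_sets_def)
    moreover have "S' = S" "out' = out @ [S]" using step iff that by auto
    ultimately show ?thesis using out by auto
  qed
  show "S' = S - {k} \<and> set out' = pd_index_sets n A - later n S"
    if "\<not> positive_definite (principal_submatrix A S)"
  proof -
    have "S' = S - {k}" "out' = out" using step iff that by auto
    moreover have "pd_index_sets n A - pending n S = pd_index_sets n A - later n S"
      using descendants_pd_index_sets_disjoint[OF A that] by (auto simp: pending_def)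
    ultimately show ?thesis using out by simp
  qed
qed

text \<open>There are three moves: to the first child of an accepted set, to the next sibling of a rejected
  set, and, at \<open>k = n\<close>, to the next sibling of the parent. In the last case the parent has a
  positive definite principal submatrix by the invariant, hence so has the grandparent, which is
  the parent of the new current set.\<close>

lemma step_invariant:
  assumes A: "A \<in> carrier_mat n n" and sym: "symmetric_matrix A"
    and inv: "invariant n A (k, S, out)" and ne: "S \<noteq> {}"
    and step: "step2 n (step1 A (k, S, out)) = (k', S', out')"
  shows "invariant n A (k', S', out') \<and> card (pending n S') < card (pending n S)"
proof -
  from inv ne have S: "S \<subseteq> {1..n}" and k: "k = Max S"
    and pd: "positive_definite (principal_submatrix A (S - {k}))"
    by (auto simp: invariant_def)
  have fin: "finite S" using S finite_subset by blast
  have kS: "k \<in> S" using fin ne k by simp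
  then have kn: "k \<le> n" using S by auto
  have le: "s \<le> k" if "s \<in> S" for s using that fin k by simp
  obtain S1 out1 where s1: "step1 A (k, S, out) = (k, S1, out1)"
    by (cases "step1 A (k, S, out)") (use set_out_step1(1)[OF A sym inv ne] in blast)
  note out1 = set_out_step1(2,3)[OF A sym inv ne s1]
  have self: "S \<in> pending n S" "S \<notin> later n S"
    using self_in_descendants[OF S ne] descendants_later_disjoint[of n S]
    by (auto simp: pending_def)
  have main: "S' \<subseteq> {1..n} \<and> (S' \<noteq> {} \<longrightarrow> k' = Max S' \<and>
      positive_definite (principal_submatrix A (S' - {k'}))) \<and>
      set out' = pd_index_sets n A - pending n S' \<and> pending n S' \<subseteq> pending n S - {S}"
  proof (cases "k < n")
    case True
    then have st: "k' = k + 1" "S' = insert (k + 1) S1" "out' = out1"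
      using step s1 by auto
    show ?thesis
    proof (cases "positive_definite (principal_submatrix A S)")
      case pdS: True
      with out1(1) have S1: "S1 = S" "set out1 = pd_index_sets n A - (pending n S - {S})" by auto
      have "Max S' = k + 1" using st S1 Max_insert_Suc[OF fin le] by simp
      moreover have "S' - {k + 1} = S" using st S1 le by force
      moreover have "pending n S' = pending n S - {S}"
        using pending_extend[OF S ne k[symmetric] True] st S1 by simp
      ultimately show ?thesis using st S1 pdS S True by auto
    next
      case False
      with out1(2) have S1: "S1 = S - {k}" "set out1 = pd_index_sets n A - later n S" by auto
      have "Max S' = k + 1" using st S1 Max_insert_Suc[of S1 k] fin le by simp
      moreover have "S' - {k + 1} = S - {k}" using st S1 le by force
      moreover have "pending n S' = later n S"
        using pending_advance[OF S ne k[symmetric] True] st S1 by simp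
      ultimately show ?thesis using st S1 pd S True self by (auto simp: pending_def)
    qed
  next
    case False
    with kn have [simp]: "k = n" by simp
    let ?T = "S - {n}"
    \<comment> \<open>A leaf is its whole subtree, so acceptance and rejection leave the same sets pending.\<close>
    have "descendants n S = {S}"
      using descendants_Max_eq_n[OF S ne] k by simp
    then have "pending n S - {S} = later n S" using self by (auto simp: pending_def)
    with out1 have out1': "set out1 = pd_index_sets n A - later n S" and "S1 - {n} = ?T" by auto
    then have st: "step2 n (k, S1, out1) = (k', S', out')" using step s1 by simp
    have T: "?T \<subseteq> {1..n}" and finT: "finite ?T" using S fin by auto
    have later: "later n S = later n ?T" by (simp add: later_remove_n)
    have sub: "later n S \<subseteq> pending n S - {S}" using self by (auto simp: pending_def)
    show ?thesis
    proof (cases "?T = {}")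
      case True
      then have "S' = {}" "out' = out1" using st \<open>S1 - {n} = ?T\<close> by (auto simp: Let_def)
      moreover have "later n S = {}" unfolding later True by (simp add: later_def)
      ultimately show ?thesis using out1' by (simp add: pending_empty)
    next
      case False
      define m where "m = Max ?T"
      have st': "k' = m + 1" "S' = insert (m + 1) (?T - {m})" "out' = out1"
        using st \<open>S1 - {n} = ?T\<close> False by (auto simp: Let_def m_def)
      have "m \<in> ?T" unfolding m_def by (rule Max_in[OF finT False])
      then have mn: "m < n" using S by force
      have leT: "s \<le> m" if "s \<in> ?T" for s using that finT by (simp add: m_def)
      have "Max S' = m + 1" unfolding st'(2) using finT leT by (intro Max_insert_Suc) auto
      moreover have "S' - {m + 1} = ?T - {m}" unfolding st'(2) using leT by force
      moreover have "positive_definite (principal_submatrix A (?T - {m}))"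
        using positive_definite_principal_submatrix_remove_Max[OF A T False] pd by (simp add: m_def)
      moreover have "pending n S' = later n S"
        using pending_advance[OF T False m_def[symmetric] mn] st'(2) later by simp
      moreover have "S' \<subseteq> {1..n}" using st'(2) T mn by auto
      ultimately show ?thesis using st' out1' sub by simp
    qed
  qed
  then have "pending n S' \<subseteq> pending n S - {S}" by (elim conjE)
  with self(1) have "pending n S' \<subset> pending n S" by blast
  then have "card (pending n S') < card (pending n S)"
    by (rule psubset_card_mono[OF finite_pending])
  moreover from main have "invariant n A (k', S', out')"
    unfolding invariant_def prod.case by (elim conjE) (intro conjI)
  ultimately show ?thesis by blast
qed

theorem mainTheorem2:
  fixes n :: nat and A :: "real mat"
  assumes "n \<ge> 1"
    and "A \<in> carrier_mat n n"
    and "symmetric_matrix A"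
  shows "\<exists>out. run_procedure n A = Some out \<and>
           set out = {S. S \<noteq> {} \<and> S \<subseteq> {1..n} \<and> positive_definite (principal_submatrix A S)}"
proof -
  let ?b = "\<lambda>(k, S, out). S \<noteq> {}" and ?c = "\<lambda>s. step2 n (step1 A s)"
  have step: "invariant n A (?c s) \<and>
      card (pending n (fst (snd (?c s)))) < card (pending n (fst (snd s)))"
    if "invariant n A s" "?b s" for s
  proof -
    obtain k S out where s: "s = (k, S, out)" by (cases s)
    obtain k' S' out' where s': "?c s = (k', S', out')" by (cases "?c s")
    have inv: "invariant n A (k, S, out)" and ne: "S \<noteq> {}"
      using that unfolding s by auto
    have "step2 n (step1 A (k, S, out)) = (k', S', out')"
      using s' unfolding s .
    from step_invariant[OF assms(2,3) inv ne this] show ?thesis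
      unfolding s' unfolding s fst_conv snd_conv .
  qed
  have init: "invariant n A (1, {1}, [])"
  proof -
    have "pd_index_sets n A - pending n {1} = {}"
      unfolding initial_pending[OF assms(1)] by (auto simp: pd_index_sets_def)
    then show ?thesis
      using assms(1) positive_definite_empty[OF assms(2)] by (simp add: invariant_def)
  qed
  have "\<exists>s. while_option ?b ?c (1, {1}, []) = Some s"
    using step init by (rule measure_while_option_Some)
  then obtain k S out where result: "while_option ?b ?c (1, {1}, []) = Some (k, S, out)"
    by (metis prod_cases3)
  have "S = {}" using while_option_stop[OF result] by simp
  moreover have "invariant n A (k, S, out)"
    using while_option_rule[of "invariant n A", OF conjunct1[OF step] result init] .
  ultimately have "set out = pd_index_sets n A" by (simp add: invariant_def pending_empty)
  with result show ?thesis by (simp add: run_procedure_def pd_index_sets_def)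
qed

end
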